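(* Let $m,n\ge 1$ and let $A$ be a $2m$-th order $n$-dimensional Hermitian tensor with conjugate partial symmetrization $S_A$. If $S_A$ is diagonally dominated, then $A$ is Hermitian positive semidefinite. If $S_A$ is strictly diagonally dominated, then $A$ is Hermitian positive definite.
   Context: A $2m$-th order $n$-dimensional complex tensor is an array $A=(a_{i_1\cdots i_m\bar{j}_1\cdots \bar{j}_m})$ of complex numbers indexed by $1\le i_1,\dots,i_m,j_1,\dots,j_m\le n$ (the bars on the last $m$ indices are only notation). It is Hermitian if $\overline{a_{i_1\cdots i_m\bar{j}_1\cdots \bar{j}_m}}=a_{j_1\cdots j_m\bar{i}_1\cdots \bar{i}_m}$ for all indices. The conjugate partial symmetrization of a Hermitian tensor $A$ is $S_A=(b_{i_1\cdots i_m\bar{j}_1\cdots\bar{j}_m})$, $b_{i_1\cdots i_m\bar{j}_1\cdots\bar{j}_m}=\frac{1}{(m!)^2}\sum_{\sigma,\tau\in S_m}a_{i_{\sigma(1)}\cdots i_{\sigma(m)}\bar{j}_{\tau(1)}\cdots\bar{j}_{\tau(m)}}$, with $S_m$ the group of permutations of $\{1,\dots,m\}$; $S_A$ is again Hermitian. For a tensor $T=(t_{i_1\cdots i_m\bar{j}_1\cdots\bar{j}_m})$ put $r_i(T)=\sum_{(i_2,\dots,i_m,j_1,\dots,j_m)\ne(i,\dots,i)}|t_{ii_2\cdots i_m\bar{j}_1\cdots\bar{j}_m}|$. A Hermitian tensor $T$ is diagonally dominated (strictly diagonally dominated) if $t_{i\cdots i\bar{i}\cdots\bar{i}}\ge r_i(T)$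 ($>r_i(T)$) for every $1\le i\le n$. $A$ is Hermitian positive definite (semidefinite) if $\sum a_{i_1\cdots i_m\bar{j}_1\cdots \bar{j}_m}x_{i_1}\cdots x_{i_m}\overline{x_{j_1}}\cdots\overline{x_{j_m}}>0$ ($\ge 0$) for every $\mathbf{x}\in\mathbb{C}^n\setminus\{0\}$, the sum being over all indices from $1$ to $n$. *)

theory Defs
  imports "HOL-Analysis.Analysis" "HOL-Library.Complex_Order"
begin

text \<open>
  The dimension is the cardinality of the finite index type \<open>'n\<close>; the order is \<open>2 * m\<close> for a number
  \<open>m\<close>.  A multi-index \<open>(i\<^sub>1, \<dots>, i\<^sub>m)\<close> is an extensional function on \<open>{1..m}\<close>, and \<open>A I J\<close> is the entry
  with unbarred indices \<open>I\<close> and barred indices \<open>J\<close>.  Values of \<open>A\<close> outside \<open>multi_indices m\<close> are junk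
  and never used.
\<close>

type_synonym 'n tensor = "(nat \<Rightarrow> 'n) \<Rightarrow> (nat \<Rightarrow> 'n) \<Rightarrow> complex"

definition multi_indices :: "nat \<Rightarrow> (nat \<Rightarrow> 'n) set" where
  "multi_indices m = {1..m} \<rightarrow>\<^sub>E UNIV"

definition const_index :: "nat \<Rightarrow> 'n \<Rightarrow> (nat \<Rightarrow> 'n)" where
  "const_index m i = (\<lambda>k\<in>{1..m}. i)"

definition hermitian_tensor :: "nat \<Rightarrow> 'n tensor \<Rightarrow> bool" where
  "hermitian_tensor m A \<longleftrightarrow>
     (\<forall>I\<in>multi_indices m. \<forall>J\<in>multi_indices m. cnj (A I J) = A J I)"

text \<open>
  \<open>I \<circ> \<sigma>\<close> is \<open>(i\<^bsub>\<sigma>(1)\<^esub>, \<dots>, i\<^bsub>\<sigma>(m)\<^esub>)\<close>; it is again extensional, because \<open>\<sigma> permutes {1..m}\<close> makes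
  \<open>\<sigma>\<close> the identity outside \<open>{1..m}\<close>.
\<close>

definition conj_partial_sym :: "nat \<Rightarrow> 'n tensor \<Rightarrow> 'n tensor" where
  "conj_partial_sym m A = (\<lambda>I J.
     1 / (fact m)\<^sup>2 *
     (\<Sum>\<sigma> | \<sigma> permutes {1..m}. \<Sum>\<tau> | \<tau> permutes {1..m}. A (I \<circ> \<sigma>) (J \<circ> \<tau>)))"

definition off_diag_row_sum :: "nat \<Rightarrow> ('n::finite) tensor \<Rightarrow> 'n \<Rightarrow> real" where
  "off_diag_row_sum m T i =
     (\<Sum>(I, J) \<in> {(I, J) \<in> multi_indices m \<times> multi_indices m.
                    I 1 = i \<and> (I, J) \<noteq> (const_index m i, const_index m i)}. cmod (T I J))"

text \<open>
  The inequalities below are in the order of \<open>Complex_Order\<close>, so they include that the two sides have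
  equal imaginary parts.  This adds no condition for Hermitian tensors, whose diagonal entries and
  associated forms are real.
\<close>

definition diag_dominated :: "nat \<Rightarrow> ('n::finite) tensor \<Rightarrow> bool" where
  "diag_dominated m T \<longleftrightarrow>
     (\<forall>i. T (const_index m i) (const_index m i) \<ge> complex_of_real (off_diag_row_sum m T i))"

definition strictly_diag_dominated :: "nat \<Rightarrow> ('n::finite) tensor \<Rightarrow> bool" where
  "strictly_diag_dominated m T \<longleftrightarrow>
     (\<forall>i. T (const_index m i) (const_index m i) > complex_of_real (off_diag_row_sum m T i))"

definition tensor_form :: "nat \<Rightarrow> ('n::finite) tensor \<Rightarrow> complex ^ 'n \<Rightarrow> complex" where
  "tensor_form m A x =
     (\<Sum>I\<in>multi_indices m. \<Sum>J\<in>multi_indices m.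
        A I J * (\<Prod>k=1..m. x $ I k) * (\<Prod>k=1..m. cnj (x $ J k)))"

definition hermitian_pos_def :: "nat \<Rightarrow> ('n::finite) tensor \<Rightarrow> bool" where
  "hermitian_pos_def m A \<longleftrightarrow> hermitian_tensor m A \<and> (\<forall>x. x \<noteq> 0 \<longrightarrow> tensor_form m A x > 0)"

definition hermitian_pos_semidef :: "nat \<Rightarrow> ('n::finite) tensor \<Rightarrow> bool" where
  "hermitian_pos_semidef m A \<longleftrightarrow> hermitian_tensor m A \<and> (\<forall>x. x \<noteq> 0 \<longrightarrow> tensor_form m A x \<ge> 0)"

end

theory Submission
  imports Defs
begin

text \<open>
  Partial symmetrization does not change the associated form, since permuting the factors of a
  monomial leaves it unchanged.  In the form of \<open>T = S\<^sub>A\<close>, bound an off-diagonal monomial by AM-GM: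
  with \<open>a = \<Prod>\<bar>x\<^bsub>I(k)\<^esub>\<bar>\<close> and \<open>b = \<Prod>\<bar>x\<^bsub>J(k)\<^esub>\<bar>\<close> we have \<open>2 a b \<le> a\<^sup>2 + b\<^sup>2\<close>, and \<open>a\<^sup>2\<close> is at most the mean of the
  numbers \<open>\<bar>x\<^bsub>I(k)\<^esub>\<bar>\<^sup>2\<^sup>m\<close>.  By symmetry of \<open>T\<close> in the unbarred indices, and by Hermitian symmetry for the
  barred ones, each slot contributes the same sum as the first, so the form is at least
  \<open>\<Sum>i. (t\<^bsub>i\<dots>i\<^esub> - r\<^sub>i) \<bar>x\<^sub>i\<bar>\<^sup>2\<^sup>m\<close>.
\<close>

section \<open>Multi-indices and permutations of their slots\<close>

lemma finite_multi_indices [simp]: "finite (multi_indices m :: (nat \<Rightarrow> 'n::finite) set)"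
  by (simp add: multi_indices_def finite_PiE)

lemma const_index_in_multi_indices [simp]: "const_index m i \<in> multi_indices m"
  by (auto simp: const_index_def multi_indices_def)

lemma const_index_apply [simp]: "k \<in> {1..m} \<Longrightarrow> const_index m i k = i"
  by (simp add: const_index_def)

lemma multi_indices_comp:
  assumes "I \<in> multi_indices m" "\<sigma> permutes {1..m}"
  shows "I \<circ> \<sigma> \<in> multi_indices m"
  using permutes_not_in[OF assms(2)] assms(1)
  by (simp add: multi_indices_def PiE_iff extensional_def)

lemma const_index_comp:
  assumes "\<sigma> permutes {1..m}"
  shows "const_index m i \<circ> \<sigma> = const_index m i"
proof
  fix k
  show "(const_index m i \<circ> \<sigma>) k = const_index m i k"
    using permutes_in_image[OF assms, of k] by (simp add: const_index_def restrict_def)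
qed

lemma comp_permutes_cancel:
  assumes "\<sigma> permutes S"
  shows "I \<circ> inv \<sigma> \<circ> \<sigma> = I" "I \<circ> \<sigma> \<circ> inv \<sigma> = I"
  using permutes_inv_o[OF assms] by (simp_all add: comp_assoc)

lemma sum_multi_indices_comp:
  assumes "\<sigma> permutes {1..m}"
  shows "(\<Sum>I\<in>multi_indices m. f (I \<circ> \<sigma>)) = (\<Sum>I\<in>multi_indices m. f I)"
  \<comment> \<open>\<open>One_nat_def\<close> would turn \<open>{1..m}\<close> into
    \<open>{Suc 0..m}\<close>, which the permutation hypotheses no longer match.\<close>
  by (rule sum.reindex_bij_witness[where i = "\<lambda>I. I \<circ> inv \<sigma>" and j = "\<lambda>I. I \<circ> \<sigma>"])
     (simp_all add: comp_permutes_cancel[OF assms] multi_indices_comp assms permutes_inv[OF assms]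
       del: One_nat_def)

lemma prod_comp_permutes:
  assumes "\<sigma> permutes S"
  shows "(\<Prod>k\<in>S. f ((I \<circ> \<sigma>) k)) = (\<Prod>k\<in>S. f (I k))"
  using prod.permute[OF assms, of "\<lambda>k. f (I k)"] by (simp add: o_def)

section \<open>The form and the symmetries of the symmetrization\<close>

lemma tensor_form_comp:
  assumes "\<sigma> permutes {1..m}" "\<tau> permutes {1..m}"
  shows "tensor_form m (\<lambda>I J. A (I \<circ> \<sigma>) (J \<circ> \<tau>)) x = tensor_form m A x"
proof -
  define p where "p I = (\<Prod>k=1..m. x $ I k)" for I
  define q where "q J = (\<Prod>k=1..m. cnj (x $ J k))" for J
  have p: "p (I \<circ> \<sigma>) = p I" for I
    unfolding p_def by (rule prod_comp_permutes[OF assms(1)])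
  have q: "q (J \<circ> \<tau>) = q J" for J
    unfolding q_def by (rule prod_comp_permutes[OF assms(2)])
  \<comment> \<open>Permuting the monomials as well makes each summand a function of
    \<open>I \<circ> \<sigma>\<close> and \<open>J \<circ> \<tau>\<close> alone, so both sums can be
    reindexed.\<close>
  have "tensor_form m (\<lambda>I J. A (I \<circ> \<sigma>) (J \<circ> \<tau>)) x =
      (\<Sum>I\<in>multi_indices m. \<Sum>J\<in>multi_indices m. A (I \<circ> \<sigma>) (J \<circ> \<tau>) * p (I \<circ> \<sigma>) * q (J \<circ> \<tau>))"
    by (simp only: p q) (simp add: tensor_form_def p_def q_def)
  also have "\<dots> = (\<Sum>I\<in>multi_indices m. \<Sum>J\<in>multi_indices m. A (I \<circ> \<sigma>) J * p (I \<circ> \<sigma>) * q J)"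
    by (intro sum.cong refl sum_multi_indices_comp assms(2))
  also have "\<dots> = (\<Sum>I\<in>multi_indices m. \<Sum>J\<in>multi_indices m. A I J * p I * q J)"
    by (rule sum_multi_indices_comp[OF assms(1)])
  finally show ?thesis
    by (simp add: tensor_form_def p_def q_def)
qed

lemma tensor_form_sum:
  "tensor_form m (\<lambda>I J. \<Sum>s\<in>S. F s I J) x = (\<Sum>s\<in>S. tensor_form m (F s) x)"
proof -
  define t where
    "t s I J = F s I J * (\<Prod>k=1..m. x $ I k) * (\<Prod>k=1..m. cnj (x $ J k))" for s I J
  have "(\<Sum>s\<in>S. \<Sum>I\<in>multi_indices m. \<Sum>J\<in>multi_indices m. t s I J) =
      (\<Sum>I\<in>multi_indices m. \<Sum>s\<in>S. \<Sum>J\<in>multi_indices m. t s I J)"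
    by (rule sum.swap)
  also have "\<dots> = (\<Sum>I\<in>multi_indices m. \<Sum>J\<in>multi_indices m. \<Sum>s\<in>S. t s I J)"
    by (intro sum.cong refl sum.swap)
  finally show ?thesis
    unfolding tensor_form_def sum_distrib_right t_def by (rule sym)
qed

lemma tensor_form_scale: "tensor_form m (\<lambda>I J. c * A I J) x = c * tensor_form m A x"
  by (simp add: tensor_form_def sum_distrib_left mult.assoc)

text \<open>The symmetrization is the average of \<open>(fact m)\<^sup>2\<close> slot-permuted
  copies of \<open>A\<close>, and each copy has the same form as \<open>A\<close>.\<close>

lemma tensor_form_conj_partial_sym: "tensor_form m (conj_partial_sym m A) x = tensor_form m A x"
proof -
  have "tensor_form m (conj_partial_sym m A) x =
      1 / (fact m)\<^sup>2 * (\<Sum>\<sigma> | \<sigma> permutes {1..m}. \<Sum>\<tau> | \<tau> permutes {1..m}. tensor_form m A x)"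
    unfolding conj_partial_sym_def tensor_form_scale tensor_form_sum
    by (intro arg_cong2[where f = times] refl sum.cong) (simp add: tensor_form_comp del: One_nat_def)
  also have "\<dots> = tensor_form m A x"
    using card_permutations[of "{1..m}" m] by (simp add: power2_eq_square)
  finally show ?thesis .
qed

text \<open>Conjugation exchanges the two arguments of \<open>A\<close>, and with them the roles of
  \<open>\<sigma>\<close> and \<open>\<tau>\<close>; the double sum is symmetric in these.\<close>

lemma hermitian_conj_partial_sym:
  assumes "hermitian_tensor m A"
  shows "hermitian_tensor m (conj_partial_sym m A)"
  unfolding hermitian_tensor_def
proof (intro ballI)
  fix I J :: "nat \<Rightarrow> 'a"
  assume "I \<in> multi_indices m" "J \<in> multi_indices m"
  then have "cnj (conj_partial_sym m A I J) =
      1 / (fact m)\<^sup>2 * (\<Sum>\<sigma> | \<sigma> permutes {1..m}. \<Sum>\<tau> | \<tau> permutes {1..m}. A (J \<circ> \<tau>) (I \<circ> \<sigma>))"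
    using assms by (simp add: conj_partial_sym_def hermitian_tensor_def multi_indices_comp)
  also have "\<dots> = conj_partial_sym m A J I"
    unfolding conj_partial_sym_def by (subst sum.swap) (rule refl)
  finally show "cnj (conj_partial_sym m A I J) = conj_partial_sym m A J I" .
qed

text \<open>Left composition with \<open>\<pi>\<close> is a bijection on the permutations, so the
  sum over \<open>\<sigma>\<close> is only reordered. The barred slots will be reached through
  Hermitian symmetry instead.\<close>

lemma conj_partial_sym_comp_left:
  assumes "\<pi> permutes {1..m}"
  shows "conj_partial_sym m A (I \<circ> \<pi>) J = conj_partial_sym m A I J"
  unfolding conj_partial_sym_def comp_assoc
  by (subst setum_permutations_compose_left[OF assms]) (rule refl)

section \<open>The inequality of arithmetic and geometric means\<close>

lemma prod_le_mean_power:
  fixes y :: "'a \<Rightarrow> real"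
  assumes "finite S" "\<And>i. i \<in> S \<Longrightarrow> y i \<ge> 0"
  shows "real (card S) * (\<Prod>i\<in>S. y i) \<le> (\<Sum>i\<in>S. y i ^ card S)"
proof (cases "S = {}")
  case False
  then have c: "card S > 0"
    using assms(1) by (simp add: card_gt_0_iff)
  \<comment> \<open>The mean inequality is applied to the powers \<open>y i ^ card S\<close>, whose
    geometric mean is \<open>P\<close>. The case \<open>P = 0\<close> is separate below because
    \<open>powr_realpow\<close> needs a positive base.\<close>
  define P where "P = (\<Prod>i\<in>S. y i)"
  have "P \<ge> 0"
    unfolding P_def using assms(2) by (rule prod_nonneg)
  then have "(P ^ card S) powr (1 / card S) = P"
    using c by (cases "P = 0") (simp_all add: powr_powr flip: powr_realpow)
  then have "(\<Prod>i\<in>S. y i ^ card S) powr (1 / card S) = (\<Prod>i\<in>S. y i)"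
    by (simp add: P_def prod_power_distrib)
  then have "(\<Prod>i\<in>S. y i) \<le> (\<Sum>i\<in>S. y i ^ card S) / card S"
    using arith_geom_mean[OF assms(1) False, of "\<lambda>i. y i ^ card S"] assms(2)
    by (simp add: sum_divide_distrib)
  then show ?thesis
    using c by (simp add: field_simps)
qed simp

section \<open>Off-diagonal entries and row sums\<close>

definition off_diag_pairs :: "nat \<Rightarrow> ((nat \<Rightarrow> 'n) \<times> (nat \<Rightarrow> 'n)) set" where
  "off_diag_pairs m =
     multi_indices m \<times> multi_indices m - range (\<lambda>i. (const_index m i, const_index m i))"

lemma finite_off_diag_pairs [simp]:
  "finite (off_diag_pairs m :: ((nat \<Rightarrow> 'n::finite) \<times> (nat \<Rightarrow> 'n)) set)"
  by (simp add: off_diag_pairs_def)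

lemma off_diag_pairs_swap: "(J, I) \<in> off_diag_pairs m \<longleftrightarrow> (I, J) \<in> off_diag_pairs m"
  by (auto simp: off_diag_pairs_def)

lemma off_diag_pairs_comp:
  assumes "(I, J) \<in> off_diag_pairs m" "\<sigma> permutes {1..m}"
  shows "(I \<circ> \<sigma>, J) \<in> off_diag_pairs m"
proof -
  have "I = const_index m i" if "I \<circ> \<sigma> = const_index m i" for i
    using that comp_permutes_cancel(2)[OF assms(2), of I]
      const_index_comp[OF permutes_inv[OF assms(2)], of i] by simp
  then show ?thesis
    using assms by (auto simp: off_diag_pairs_def multi_indices_comp)
qed

lemma sum_off_diag_first:
  fixes T :: "('n::finite) tensor" and g :: "'n \<Rightarrow> real"
  assumes "m \<ge> 1"
  shows "(\<Sum>(I, J)\<in>off_diag_pairs m. cmod (T I J) * g (I 1)) =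
         (\<Sum>i\<in>UNIV. off_diag_row_sum m T i * g i)"
proof -
  \<comment> \<open>Since \<open>m \<ge> 1\<close>, a diagonal pair is determined by its entry in
    slot 1. Among the pairs with \<open>I 1 = i\<close>, excluding the constant pair at
    \<open>i\<close> therefore excludes all diagonal pairs.\<close>
  have row: "{(I, J) \<in> multi_indices m \<times> multi_indices m.
        I 1 = i \<and> (I, J) \<noteq> (const_index m i, const_index m i)} =
      {p \<in> off_diag_pairs m. fst p 1 = i}" for i :: 'n
    using assms by (auto simp: off_diag_pairs_def)
  have "(\<Sum>(I, J)\<in>off_diag_pairs m. cmod (T I J) * g (I 1)) =
      (\<Sum>i\<in>UNIV. \<Sum>(I, J) | (I, J) \<in> off_diag_pairs m \<and> fst (I, J) 1 = i. cmod (T I J) * g (I 1))"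
    using sum.group[of "off_diag_pairs m" UNIV "\<lambda>p. fst p 1"
        "\<lambda>(I, J). cmod (T I J) * g (I 1)"] by (simp add: case_prod_unfold)
  also have "\<dots> = (\<Sum>i\<in>UNIV. off_diag_row_sum m T i * g i)"
    unfolding off_diag_row_sum_def row sum_distrib_right
    by (intro sum.cong) auto
  finally show ?thesis .
qed

text \<open>Transposing slots 1 and \<open>k\<close> is an involution on the off-diagonal pairs that
  preserves \<open>T\<close> and moves the entry of slot \<open>k\<close> to slot 1, where grouping
  by rows applies.\<close>

lemma sum_off_diag_slot:
  fixes T :: "('n::finite) tensor" and g :: "'n \<Rightarrow> real"
  assumes sym: "\<And>\<sigma> I J. \<sigma> permutes {1..m} \<Longrightarrow> T (I \<circ> \<sigma>) J = T I J"
    and k: "k \<in> {1..m}"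
  shows "(\<Sum>(I, J)\<in>off_diag_pairs m. cmod (T I J) * g (I k)) =
         (\<Sum>i\<in>UNIV. off_diag_row_sum m T i * g i)"
proof -
  define \<tau> where "\<tau> = Transposition.transpose 1 k"
  have \<tau>: "\<tau> permutes {1..m}"
    unfolding \<tau>_def using k by (intro permutes_swap_id) auto
  have [simp]: "I \<circ> \<tau> \<circ> \<tau> = I" "\<tau> 1 = k" for I :: "nat \<Rightarrow> 'n"
    by (simp_all add: \<tau>_def comp_assoc)
  have "(\<Sum>(I, J)\<in>off_diag_pairs m. cmod (T I J) * g (I k)) =
      (\<Sum>(I, J)\<in>off_diag_pairs m. cmod (T I J) * g (I 1))"
    by (rule sum.reindex_bij_witness[where i = "\<lambda>(I, J). (I \<circ> \<tau>, J)" and j = "\<lambda>(I, J). (I \<circ> \<tau>, J)"])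
       (auto simp: sym[OF \<tau>] off_diag_pairs_comp[OF _ \<tau>] simp del: One_nat_def)
  also have "\<dots> = (\<Sum>i\<in>UNIV. off_diag_row_sum m T i * g i)"
    using k by (intro sum_off_diag_first) auto
  finally show ?thesis .
qed

lemma sum_off_diag_monomial_le:
  fixes T :: "('n::finite) tensor" and x :: "complex ^ 'n"
  assumes m: "m \<ge> 1" and herm: "hermitian_tensor m T"
    and sym: "\<And>\<sigma> I J. \<sigma> permutes {1..m} \<Longrightarrow> T (I \<circ> \<sigma>) J = T I J"
  shows "(\<Sum>(I, J)\<in>off_diag_pairs m.
            cmod (T I J) * ((\<Prod>k=1..m. cmod (x $ I k)) * (\<Prod>k=1..m. cmod (x $ J k)))) \<le>
         (\<Sum>i\<in>UNIV. off_diag_row_sum m T i * cmod (x $ i) ^ (2 * m))"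
    (is "_ \<le> ?R")
proof -
  define a where "a I = (\<Prod>k=1..m. cmod (x $ I k))" for I
  \<comment> \<open>The mean inequality for the \<open>m\<close> numbers
    \<open>(cmod (x $ I k))\<^sup>2\<close>, whose \<open>m\<close>-th powers have exponent
    \<open>2 * m\<close>. The factor \<open>real m\<close> is kept to avoid division and cancelled
    once all slots are summed.\<close>
  have a2: "real m * (a I)\<^sup>2 \<le> (\<Sum>k=1..m. cmod (x $ I k) ^ (2 * m))" for I
    using prod_le_mean_power[of "{1..m}" "\<lambda>k. (cmod (x $ I k))\<^sup>2"]
    by (simp add: a_def prod_power_distrib power_mult)
  have le1: "real m * (cmod (T I J) * (a I)\<^sup>2) \<le>
      cmod (T I J) * (\<Sum>k=1..m. cmod (x $ I k) ^ (2 * m))" for I J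
    using mult_left_mono[OF a2[of I], of "cmod (T I J)"] by (simp add: mult_ac)
  have "real m * (\<Sum>(I, J)\<in>off_diag_pairs m. cmod (T I J) * (a I)\<^sup>2) \<le>
      (\<Sum>(I, J)\<in>off_diag_pairs m. cmod (T I J) * (\<Sum>k=1..m. cmod (x $ I k) ^ (2 * m)))"
    unfolding sum_distrib_left[of "real m"] case_prod_unfold by (intro sum_mono le1)
  also have "\<dots> = (\<Sum>k=1..m. \<Sum>(I, J)\<in>off_diag_pairs m. cmod (T I J) * cmod (x $ I k) ^ (2 * m))"
    unfolding case_prod_unfold sum_distrib_left by (rule sum.swap)
  also have "\<dots> = (\<Sum>k=1..m. ?R)"
    by (intro sum.cong refl sum_off_diag_slot[where g = "\<lambda>i. cmod (x $ i) ^ (2 * m)"] sym)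
  also have "\<dots> = real m * ?R"
    by simp
  finally have le: "(\<Sum>(I, J)\<in>off_diag_pairs m. cmod (T I J) * (a I)\<^sup>2) \<le> ?R"
    using m by simp
  have abs_sym: "cmod (T J I) = cmod (T I J)" if "(I, J) \<in> off_diag_pairs m" for I J
  proof -
    from that herm have "cnj (T I J) = T J I"
      unfolding off_diag_pairs_def hermitian_tensor_def by auto
    then show ?thesis
      by (metis complex_mod_cnj)
  qed
  \<comment> \<open>The barred monomials need no estimate of their own: exchanging \<open>I\<close>
    and \<open>J\<close> preserves both the index set and the modulus of the entry.\<close>
  have swap: "(\<Sum>(I, J)\<in>off_diag_pairs m. cmod (T I J) * (a J)\<^sup>2) =
      (\<Sum>(I, J)\<in>off_diag_pairs m. cmod (T I J) * (a I)\<^sup>2)"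
    by (rule sum.reindex_bij_witness[where i = prod.swap and j = prod.swap])
       (auto simp: off_diag_pairs_swap abs_sym)
  have le2: "2 * (cmod (T I J) * (a I * a J)) \<le> cmod (T I J) * (a I)\<^sup>2 + cmod (T I J) * (a J)\<^sup>2"
    for I J
    using mult_left_mono[OF sum_squares_bound[of "a I" "a J"], of "cmod (T I J)"]
    by (simp add: algebra_simps)
  have "2 * (\<Sum>(I, J)\<in>off_diag_pairs m. cmod (T I J) * (a I * a J)) \<le>
      (\<Sum>(I, J)\<in>off_diag_pairs m. cmod (T I J) * (a I)\<^sup>2) +
      (\<Sum>(I, J)\<in>off_diag_pairs m. cmod (T I J) * (a J)\<^sup>2)"
    unfolding sum_distrib_left case_prod_unfold sum.distrib[symmetric] by (intro sum_mono le2)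
  with le swap show ?thesis
    by (simp add: a_def)
qed

section \<open>The lower bound for the form\<close>

lemma Im_tensor_form:
  assumes "hermitian_tensor m T"
  shows "Im (tensor_form m T x) = 0"
proof -
  \<comment> \<open>Hermitian symmetry turns conjugation into an exchange of the summation
    variables, so the form equals its own conjugate.\<close>
  have "cnj (tensor_form m T x) = (\<Sum>I\<in>multi_indices m. \<Sum>J\<in>multi_indices m.
        T J I * (\<Prod>k=1..m. x $ J k) * (\<Prod>k=1..m. cnj (x $ I k)))"
    using assms unfolding tensor_form_def hermitian_tensor_def
    by (auto simp: mult_ac intro!: sum.cong)
  also have "\<dots> = tensor_form m T x"
    unfolding tensor_form_def by (rule sum.swap)
  finally show ?thesis
    by (metis Reals_cnj_iff complex_is_Real_iff)
qed

lemma Re_tensor_form_ge: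
  fixes T :: "('n::finite) tensor" and x :: "complex ^ 'n"
  assumes m: "m \<ge> 1" and herm: "hermitian_tensor m T"
    and sym: "\<And>\<sigma> I J. \<sigma> permutes {1..m} \<Longrightarrow> T (I \<circ> \<sigma>) J = T I J"
  shows "(\<Sum>i\<in>UNIV. (Re (T (const_index m i) (const_index m i)) - off_diag_row_sum m T i) *
            cmod (x $ i) ^ (2 * m)) \<le> Re (tensor_form m T x)"
proof -
  define p where "p I = (\<Prod>k=1..m. x $ I k)" for I
  define h where "h = (\<lambda>(I, J). T I J * p I * cnj (p J))"
  let ?D = "range (\<lambda>i::'n. (const_index m i, const_index m i))"
  \<comment> \<open>Injectivity lets the sum over \<open>?D\<close> be taken over \<open>i\<close>.
    It uses \<open>m \<ge> 1\<close>: for \<open>m = 0\<close> all constant indices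
    coincide.\<close>
  have inj: "inj (\<lambda>i::'n. (const_index m i, const_index m i))"
    using m by (intro injI) (auto dest: fun_cong[where x = 1])
  have "tensor_form m T x = sum h (multi_indices m \<times> multi_indices m)"
    by (simp add: tensor_form_def h_def p_def sum.cartesian_product)
  also have "\<dots> = sum h (off_diag_pairs m) + sum h ?D"
    unfolding off_diag_pairs_def by (rule sum.subset_diff) auto
  finally have split: "Re (tensor_form m T x) = Re (sum h (off_diag_pairs m)) + Re (sum h ?D)"
    by simp
  have "h (const_index m i, const_index m i) =
      T (const_index m i) (const_index m i) * of_real (cmod (x $ i) ^ (2 * m))" for i
  proof -
    have "p (const_index m i) = (x $ i) ^ m"
      by (simp add: p_def)
    moreover have "of_real (cmod (x $ i) ^ (2 * m)) = (x $ i) ^ m * cnj ((x $ i) ^ m)"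
      by (simp add: power_mult complex_norm_square[symmetric] flip: power_mult_distrib)
    ultimately show ?thesis
      by (simp only: h_def prod.case mult.assoc)
  qed
  then have diag: "Re (sum h ?D) =
      (\<Sum>i\<in>UNIV. Re (T (const_index m i) (const_index m i)) * cmod (x $ i) ^ (2 * m))"
    by (simp add: sum.reindex[OF inj] del: of_real_power)
  \<comment> \<open>The off-diagonal part can lower the real part of the form by at most the sum of
    its moduli, while the diagonal part is known exactly.\<close>
  have "\<bar>Re (sum h (off_diag_pairs m))\<bar> \<le> (\<Sum>q\<in>off_diag_pairs m. cmod (h q))"
    by (rule order_trans[OF abs_Re_le_cmod norm_sum])
  also have "\<dots> \<le> (\<Sum>i\<in>UNIV. off_diag_row_sum m T i * cmod (x $ i) ^ (2 * m))"
    using sum_off_diag_monomial_le[OF m herm sym, of x]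
    by (simp add: h_def p_def norm_mult case_prod_unfold mult.assoc
        flip: prod_norm)
  finally show ?thesis
    using split diag by (simp add: left_diff_distrib sum_subtractf)
qed

section \<open>Positivity from diagonal dominance\<close>

theorem corollary4p9:
  fixes m :: nat and A :: "('n::finite) tensor"
  assumes "m \<ge> 1"
    and "hermitian_tensor m A"
  shows "(diag_dominated m (conj_partial_sym m A) \<longrightarrow> hermitian_pos_semidef m A) \<and>
         (strictly_diag_dominated m (conj_partial_sym m A) \<longrightarrow> hermitian_pos_def m A)"
proof -
  define T where "T = conj_partial_sym m A"
  define d where "d i = Re (T (const_index m i) (const_index m i)) - off_diag_row_sum m T i" for i
  have Im: "Im (tensor_form m A x) = 0" for x
    by (rule Im_tensor_form[OF assms(2)])
  \<comment> \<open>The bound is proved for \<open>T\<close>, which has the required symmetries, and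
    passes to \<open>A\<close> because both have the same form.\<close>
  have Re: "(\<Sum>i\<in>UNIV. d i * cmod (x $ i) ^ (2 * m)) \<le> Re (tensor_form m A x)" for x
    using Re_tensor_form_ge[OF assms(1) hermitian_conj_partial_sym[OF assms(2)]
        conj_partial_sym_comp_left, where x = x]
    by (simp add: tensor_form_conj_partial_sym d_def T_def)
  have "hermitian_pos_semidef m A" if "diag_dominated m T"
  proof -
    have "d i \<ge> 0" for i
      using that by (simp add: diag_dominated_def less_eq_complex_def d_def)
    then have "(\<Sum>i\<in>UNIV. d i * cmod (x $ i) ^ (2 * m)) \<ge> 0" for x :: "complex ^ 'n"
      by (intro sum_nonneg) simp
    then show ?thesis
      using assms(2) Im Re
      by (auto simp: hermitian_pos_semidef_def less_eq_complex_def intro: order_trans)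
  qed
  moreover have "hermitian_pos_def m A" if "strictly_diag_dominated m T"
  proof -
    have d: "d i > 0" for i
      using that by (simp add: strictly_diag_dominated_def less_complex_def d_def)
    have "(\<Sum>i\<in>UNIV. d i * cmod (x $ i) ^ (2 * m)) > 0" if "x \<noteq> 0" for x :: "complex ^ 'n"
    proof -
      \<comment> \<open>One nonzero coordinate gives a strictly positive summand; the remaining
        summands are nonnegative.\<close>
      obtain i where "x $ i \<noteq> 0"
        using \<open>x \<noteq> 0\<close> by (auto simp: vec_eq_iff)
      then show ?thesis
        using d by (intro sum_pos2[where i = i]) (simp_all add: less_imp_le)
    qed
    then show ?thesis
      using assms(2) Im Re
      by (auto simp: hermitian_pos_def_def less_complex_def intro: less_le_trans)
  qed
  ultimately show ?thesis
    by (simp add: T_def)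
qed

end
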